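(* Let $\mathbb{Z}$ be a finite dimensional real inner product space with induced norm $\|\cdot\|$, let $\mathcal{A},\mathcal{B}:\mathbb{Z}\rightrightarrows\mathbb{Z}$ be maximal monotone, put $\mathcal{F}:=\mathcal{A}+\mathcal{B}$, and assume $\mathcal{F}^{-1}(0)\neq\emptyset$. Let $\gamma>0$ and let $\{\lambda_k\}_{k\ge 0}\subseteq[0,2]$ satisfy $\sum_{k=0}^\infty\lambda_k(2-\lambda_k)=+\infty$. Let $\{x^k\},\{y^k\},\{z^k\}$ be generated from an arbitrary $x^0\in\mathbb{Z}$ by the generalized Douglas-Rachford splitting method $$z^k=\mathcal{J}_{\gamma\mathcal{B}}x^k,\qquad y^k=\mathcal{J}_{\gamma\mathcal{A}}(2z^k-x^k),\qquad x^{k+1}=x^k+\lambda_k(y^k-z^k),\qquad k\in\mathbb{N},$$ and let $\mathcal{T}:=\frac12\big((2\mathcal{J}_{\gamma\mathcal{A}}-\mathcal{I})(2\mathcal{J}_{\gamma\mathcal{B}}-\mathcal{I})+\mathcal{I}\big)$. Then the following hold. (a) $\{y^k\}$ and $\{z^k\}$ converge to a point $z^*\in\mathcal{F}^{-1}(0)$, $\{x^k\}$ converges to a point $x^*\in{\rm Fix}\,\mathcal{T}$, and $$\|x^{k+1}-x\|^2\le\|x^k-x\|^2-\lambda_k(2-\lambda_k)\|\mathcal{T}x^k-x^k\|^2\qquad\forall x\in{\rm Fix}\,\mathcal{T},\ \forall k\in\mathbb{N}.$$ (b) If $\mathcal{A}$ is single-valued and Lipschitz continuous with modulus $\frac1\beta$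 ($\beta>0$), and $\mathcal{F}$ is metrically subregular at $(z^*,0)\in{\rm gph}\,\mathcal{F}$ with constant $\kappa>0$, then there exists $\overline{k}\in\mathbb{N}$ such that for all $k\ge\overline{k}$, $${\rm dist}(x^{k+1},{\rm Fix}\,\mathcal{T})\le\sqrt{1-\frac{\lambda_k(2-\lambda_k)}{\big[2+\sqrt{1+\gamma^2\beta^{-2}}\,\big(1+\kappa(\gamma^{-1}+\beta^{-1})\big)\big]^2}}\;{\rm dist}(x^k,{\rm Fix}\,\mathcal{T}).$$ (c) If $\mathcal{B}$ is single-valued and Lipschitz continuous with modulus $\frac1\beta$ ($\beta>0$), and $\mathcal{F}$ is metrically subregular at $(z^*,0)\in{\rm gph}\,\mathcal{F}$ with constant $\kappa>0$, then there exists $\overline{k}\in\mathbb{N}$ such that for all $k\ge\overline{k}$, $${\rm dist}(x^{k+1},{\rm Fix}\,\mathcal{T})\le\sqrt{1-\frac{\beta^2\lambda_k(2-\lambda_k)}{(\gamma+\beta)^2\big(1+\kappa\sqrt{\gamma^{-2}+\beta^{-2}}\big)^2}}\;{\rm dist}(x^k,{\rm Fix}\,\mathcal{T}).$$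
   Context: For an operator $\mathcal{T}:\mathbb{Z}\rightrightarrows\mathbb{Z}$ (set-valued map) and $\gamma>0$, $\mathcal{J}_{\gamma\mathcal{T}}=(\mathcal{I}+\gamma\mathcal{T})^{-1}$ denotes its resolvent, where $\mathcal{I}$ is the identity. ${\rm gph}\,\mathcal{T}=\{(x,y): y\in\mathcal{T}(x)\}$, $\mathcal{T}^{-1}(y)=\{x: y\in\mathcal{T}(x)\}$, ${\rm Fix}\,\mathcal{T}$ is the set of fixed points of a single-valued map $\mathcal{T}$, and ${\rm dist}(x,S)=\inf_{s\in S}\|x-s\|$ (equal to $+\infty$ if $S=\emptyset$). An operator $\mathcal{A}$ that is single-valued is regarded as a map $\mathbb{Z}\to\mathbb{Z}$; it is Lipschitz continuous with modulus $\frac1\beta$ if $\|\mathcal{A}u-\mathcal{A}v\|\le\beta^{-1}\|u-v\|$ for all $u,v$. An operator $\mathcal{T}$ is metrically subregular at $(\overline{x},\overline{y})\in{\rm gph}\,\mathcal{T}$ with constant $\kappa>0$ if there is a neighborhood $U$ of $\overline{x}$ such that ${\rm dist}(x,\mathcal{T}^{-1}(\overline{y}))\le\kappa\,{\rm dist}(\overline{y},\mathcal{T}x)$ for all $x\in U$. *)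

theory Defs
  imports "HOL-Analysis.Analysis"
begin

text \<open>An operator on \<open>'a\<close> is a set-valued map \<open>'a \<Rightarrow> 'a set\<close>, possibly with empty values.\<close>

type_synonym 'a operator = "'a \<Rightarrow> 'a set"

definition gph :: "'a operator \<Rightarrow> ('a \<times> 'a) set" where
  "gph T = {(x, y). y \<in> T x}"

definition op_inverse :: "'a operator \<Rightarrow> 'a operator" where
  "op_inverse T y = {x. y \<in> T x}"

definition op_id :: "'a operator" where
  "op_id x = {x}"

definition op_add :: "'a::plus operator \<Rightarrow> 'a operator \<Rightarrow> 'a operator" where
  "op_add S T x = {u + v |u v. u \<in> S x \<and> v \<in> T x}"

definition op_scaleR :: "real \<Rightarrow> 'a::real_vector operator \<Rightarrow> 'a operator" where
  "op_scaleR c T x = {c *\<^sub>R u |u. u \<in> T x}"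

definition monotone_operator :: "'a::real_inner operator \<Rightarrow> bool" where
  "monotone_operator T \<longleftrightarrow>
     (\<forall>x y u v. (x, u) \<in> gph T \<longrightarrow> (y, v) \<in> gph T \<longrightarrow> 0 \<le> (x - y) \<bullet> (u - v))"

definition maximal_monotone :: "'a::real_inner operator \<Rightarrow> bool" where
  "maximal_monotone T \<longleftrightarrow> monotone_operator T \<and>
     (\<forall>S. monotone_operator S \<longrightarrow> gph T \<subseteq> gph S \<longrightarrow> gph S = gph T)"

definition resolvent_op :: "real \<Rightarrow> 'a::real_vector operator \<Rightarrow> 'a operator" where
  "resolvent_op \<gamma> T = op_inverse (op_add op_id (op_scaleR \<gamma> T))"

text \<open>The resolvent as a single-valued map. If \<open>T\<close> is maximal monotone and \<open>\<gamma> > 0\<close>, then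
  \<open>resolvent_op \<gamma> T x\<close> is a singleton for every \<open>x\<close> (Minty), so \<^const>\<open>the_elem\<close> makes no
  arbitrary choice.\<close>

definition resolvent :: "real \<Rightarrow> 'a::real_vector operator \<Rightarrow> 'a \<Rightarrow> 'a" where
  "resolvent \<gamma> T x = the_elem (resolvent_op \<gamma> T x)"

definition reflected_resolvent :: "real \<Rightarrow> 'a::real_vector operator \<Rightarrow> 'a \<Rightarrow> 'a" where
  "reflected_resolvent \<gamma> T x = 2 *\<^sub>R resolvent \<gamma> T x - x"

definition DR_map :: "real \<Rightarrow> 'a::real_vector operator \<Rightarrow> 'a operator \<Rightarrow> 'a \<Rightarrow> 'a" where
  "DR_map \<gamma> A B x =
     (1/2) *\<^sub>R ((reflected_resolvent \<gamma> A \<circ> reflected_resolvent \<gamma> B) x + x)"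

definition Fix :: "('a \<Rightarrow> 'a) \<Rightarrow> 'a set" where
  "Fix f = {x. f x = x}"

text \<open>Unlike \<^const>\<open>infdist\<close>, which is \<open>0\<close> on the empty set, this distance is \<open>\<infinity>\<close> there.\<close>

definition dist_set :: "'a::real_normed_vector \<Rightarrow> 'a set \<Rightarrow> ereal" where
  "dist_set x S = (INF s\<in>S. ereal (norm (x - s)))"

definition metrically_subregular ::
    "'a::real_normed_vector operator \<Rightarrow> 'a \<Rightarrow> 'a \<Rightarrow> real \<Rightarrow> bool" where
  "metrically_subregular T xb yb \<kappa> \<longleftrightarrow> (xb, yb) \<in> gph T \<and> \<kappa> > 0 \<and>
     (\<exists>U. open U \<and> xb \<in> U \<and>
        (\<forall>x\<in>U. dist_set x (op_inverse T yb) \<le> ereal \<kappa> * dist_set yb (T x)))"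

definition single_valued_lipschitz :: "real \<Rightarrow> 'a::real_normed_vector operator \<Rightarrow> bool" where
  "single_valued_lipschitz L T \<longleftrightarrow> (\<exists>f. (\<forall>x. T x = {f x}) \<and> L-lipschitz_on UNIV f)"

end

theory Submission
  imports Defs
begin

text \<open>Minty's theorem makes both resolvents single-valued, everywhere defined and continuous.
  Evaluating the resolvent of \<open>S\<close> at \<open>w\<close> amounts to finding a point common to the balls with
  diameters \<open>[p, w - \<gamma> v]\<close>, where \<open>v \<in> S p\<close>. Compactness reduces this to finitely many balls, where a
  common point comes from maximising a concave function over a convex hull
  (\<open>diameter_balls_finite\<close>).

  Write \<open>T\<close> for the Douglas--Rachford map, and \<open>z\<close> and \<open>y\<close> for the resolvent values of \<open>B\<close> and \<open>A\<close>
  computed from \<open>x\<close>, so that \<open>T x = x + y - z\<close>.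
  Adding the monotonicity inequalities of \<open>A\<close> and \<open>B\<close> shows that \<open>T\<close> is firmly nonexpansive,
  which gives the inequality of part (a) and also the monotone decrease of \<open>\<parallel>T x\<^sup>k - x\<^sup>k\<parallel>\<close>. The
  divergence of \<open>\<Sum>\<lambda>\<^sub>k (2 - \<lambda>\<^sub>k)\<close> then forces these residuals to \<open>0\<close>, so every cluster point
  of the bounded sequence \<open>x\<^sup>k\<close> is fixed, and Fejer monotonicity makes the whole sequence converge.
  The limit of \<open>z\<^sup>k\<close> is a zero of \<open>A + B\<close> by continuity of the resolvent, and \<open>y\<^sup>k - z\<^sup>k\<close>
  tends to \<open>0\<close>.

  For parts (b) and (c) the inequality of part (a) turns any bound
  \<open>dist(x, Fix T) \<le> C \<parallel>T x - x\<parallel>\<close> with \<open>C \<ge> 1\<close> into the contraction factor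
  \<open>sqrt (1 - \<lambda> (2 - \<lambda>) / C\<^sup>2)\<close> (\<open>relaxed_step_contraction\<close>). To obtain the bound, note that if
  \<open>A\<close> is single-valued, then \<open>F z\<close> contains the vector \<open>(A z - A y) + (z - y) / \<gamma>\<close>, of size
  \<open>O(\<parallel>y - z\<parallel>) = O(\<parallel>T x - x\<parallel>)\<close>; subregularity therefore places \<open>z\<close> near the zeros of \<open>F\<close>. If
  \<open>B\<close> is single-valued, the same works at \<open>y\<close> with \<open>(z - y) / \<gamma> - (B z - B y)\<close>. Finally, a
  zero \<open>p\<close> of \<open>F\<close> with \<open>b \<in> B p\<close> and \<open>-b \<in> A p\<close> yields the fixed point \<open>p + \<gamma> b\<close>, whose distance
  from \<open>x\<close> is controlled by the Lipschitz constant (\<open>error_bound_A\<close>, \<open>error_bound_B\<close>).\<close>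

section \<open>Minty's theorem\<close>

text \<open>Chebyshev's sum inequality for oppositely ordered families, with weights and inner products:
  the left-hand side minus the right-hand side is half the double sum of
  \<open>u i * u j * ((a i - a j) \<bullet> (b i - b j))\<close>.\<close>

lemma weighted_inner_le:
  fixes a b :: "'i \<Rightarrow> 'a::real_inner"
  assumes "finite I" and u: "\<And>i. i \<in> I \<Longrightarrow> 0 \<le> u i" "sum u I = 1"
    and anti: "\<And>i j. i \<in> I \<Longrightarrow> j \<in> I \<Longrightarrow> (a i - a j) \<bullet> (b i - b j) \<le> 0"
  shows "(\<Sum>i\<in>I. u i * (a i \<bullet> b i)) \<le> (\<Sum>i\<in>I. u i *\<^sub>R a i) \<bullet> (\<Sum>i\<in>I. u i *\<^sub>R b i)"
proof -
  let ?S = "\<Sum>i\<in>I. u i * (a i \<bullet> b i)"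
  let ?P = "(\<Sum>i\<in>I. u i *\<^sub>R a i) \<bullet> (\<Sum>i\<in>I. u i *\<^sub>R b i)"
  have P: "?P = (\<Sum>i\<in>I. \<Sum>j\<in>I. u i * u j * (a i \<bullet> b j))"
    by (simp add: inner_sum_left inner_sum_right sum_distrib_left mult.assoc mult.left_commute)
       (subst sum.swap, simp add: ac_simps)
  have P': "?P = (\<Sum>i\<in>I. \<Sum>j\<in>I. u i * u j * (a j \<bullet> b i))"
    by (subst P, subst sum.swap) (simp add: mult.commute mult.left_commute)
  have S: "?S = (\<Sum>i\<in>I. \<Sum>j\<in>I. u i * u j * (a i \<bullet> b i))"
    using u(2) by (simp flip: sum_distrib_left sum_distrib_right)
  have S': "?S = (\<Sum>i\<in>I. \<Sum>j\<in>I. u i * u j * (a j \<bullet> b j))"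
    by (subst S, subst sum.swap) (simp add: mult.commute)
  have "(?S + ?S) - (?P + ?P) = (\<Sum>i\<in>I. \<Sum>j\<in>I. u i * u j * ((a i - a j) \<bullet> (b i - b j)))"
    apply (subst (1) S, subst S', subst (1) P, subst P')
    by (simp add: inner_diff_left inner_diff_right algebra_simps sum.distrib sum_subtractf)
  also have "\<dots> \<le> 0"
    by (intro sum_nonpos mult_nonneg_nonpos mult_nonneg_nonneg u anti)
  finally show ?thesis by simp
qed

text \<open>The set \<open>{x. (x - a) \<bullet> (x - b) \<le> 0}\<close> is the closed ball with diameter \<open>[a, b]\<close>. In terms of
  \<open>s = a + b\<close> and \<open>t = a \<bullet> b\<close> the expression is \<open>x \<bullet> x - s \<bullet> x + t\<close>, with minimum \<open>t - (s \<bullet> s) / 4\<close>.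
  This minimum is a concave function of \<open>(s, t)\<close>; at a maximiser over the convex hull of the
  data, the point \<open>x = s / 2\<close> lies in all the balls, by the first-order condition.\<close>

lemma diameter_balls_finite:
  fixes P :: "('a::euclidean_space \<times> 'a) set"
  assumes "finite P"
    and anti: "\<And>a b a' b'. (a, b) \<in> P \<Longrightarrow> (a', b') \<in> P \<Longrightarrow> (a - a') \<bullet> (b - b') \<le> 0"
  shows "\<exists>x. \<forall>(a, b)\<in>P. (x - a) \<bullet> (x - b) \<le> 0"
proof (cases "P = {}")
  case False
  define Q where "Q = (\<lambda>p. (p, fst p \<bullet> snd p)) ` P"
  define K where "K = convex hull Q"
  define g :: "('a \<times> 'a) \<times> real \<Rightarrow> real"
    where "g q = snd q - ((fst (fst q) + snd (fst q)) \<bullet> (fst (fst q) + snd (fst q))) / 4" for q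
  have "finite Q" "Q \<noteq> {}" using assms(1) False by (auto simp: Q_def)
  have "compact K" unfolding K_def by (rule finite_imp_compact_convex_hull[OF \<open>finite Q\<close>])
  moreover have "K \<noteq> {}" using \<open>Q \<noteq> {}\<close> by (simp add: K_def)
  moreover have "continuous_on K g" unfolding g_def by (intro continuous_intros) auto
  ultimately obtain m where m: "m \<in> K" and max: "\<And>q. q \<in> K \<Longrightarrow> g q \<le> g m"
    using continuous_attains_sup[of K g] by blast
  define s where "s = fst (fst m) + snd (fst m)"
  \<comment> \<open>At a convex combination, \<open>t \<le> a \<bullet> b\<close> by the weighted inequality, and \<open>4 (a \<bullet> b) \<le> (a + b) \<bullet> (a + b)\<close>.\<close>
  have "g m \<le> 0"
  proof -
    obtain u where u: "\<forall>q\<in>Q. 0 \<le> u q" "sum u Q = 1" "(\<Sum>q\<in>Q. u q *\<^sub>R q) = m"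
      using m unfolding K_def convex_hull_finite[OF \<open>finite Q\<close>] by blast
    let ?a = "\<Sum>q\<in>Q. u q *\<^sub>R fst (fst q)" and ?b = "\<Sum>q\<in>Q. u q *\<^sub>R snd (fst q)"
    have fm: "fst (fst m) = ?a" "snd (fst m) = ?b" "snd m = (\<Sum>q\<in>Q. u q * snd q)"
      by (simp_all flip: u(3) add: fst_sum snd_sum)
    have "snd m = (\<Sum>q\<in>Q. u q * (fst (fst q) \<bullet> snd (fst q)))"
      unfolding fm by (rule sum.cong) (auto simp: Q_def)
    also have "\<dots> \<le> ?a \<bullet> ?b"
      using u anti by (intro weighted_inner_le[OF \<open>finite Q\<close>]) (auto simp: Q_def)
    finally have "snd m \<le> ?a \<bullet> ?b" .
    moreover have "0 \<le> (?a - ?b) \<bullet> (?a - ?b)" by simp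
    ultimately show ?thesis
      by (simp add: g_def fm inner_diff_left inner_diff_right inner_add_left inner_add_right inner_commute)
  qed
  have "((1/2) *\<^sub>R s - a) \<bullet> ((1/2) *\<^sub>R s - b) \<le> 0" if ab: "(a, b) \<in> P" for a b
  proof -
    define q where "q = ((a, b), a \<bullet> b)"
    have "q \<in> K" using ab by (auto simp: K_def Q_def q_def intro!: hull_inc)
    define d where "d = a + b - s"
    \<comment> \<open>On the segment from \<open>m\<close> to \<open>q\<close> the function \<open>g\<close> is quadratic; its slope at \<open>m\<close> cannot be positive.\<close>
    have line: "g ((1 - t) *\<^sub>R m + t *\<^sub>R q) = g m + t * (a \<bullet> b - snd m - s \<bullet> d / 2) - t\<^sup>2 * (d \<bullet> d / 4)"
      for t
    proof -
      have e: "fst (fst ((1 - t) *\<^sub>R m + t *\<^sub>R q)) + snd (fst ((1 - t) *\<^sub>R m + t *\<^sub>R q)) = s + t *\<^sub>R d"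
        by (simp add: q_def s_def d_def algebra_simps)
      show ?thesis unfolding g_def e
        by (simp add: s_def[symmetric] q_def inner_add_left inner_add_right inner_commute power2_eq_square field_simps)
    qed
    have step: "a \<bullet> b - snd m - s \<bullet> d / 2 \<le> t * (d \<bullet> d / 4)" if t: "0 < t" "t \<le> 1" for t
    proof -
      have "(1 - t) *\<^sub>R m + t *\<^sub>R q \<in> K"
        using convexD[OF convex_convex_hull[of Q], of m q "1 - t" t] m \<open>q \<in> K\<close> t by (simp add: K_def)
      from max[OF this] have "t * (a \<bullet> b - snd m - s \<bullet> d / 2) \<le> t * (t * (d \<bullet> d / 4))"
        by (simp add: line power2_eq_square)
      thus ?thesis using t(1) by simp
    qed
    have "a \<bullet> b - snd m - s \<bullet> d / 2 \<le> 0"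
    proof (rule tendsto_lowerbound)
      show "((\<lambda>t. t * (d \<bullet> d / 4)) \<longlongrightarrow> 0) (at_right 0)"
        by (auto intro!: tendsto_eq_intros)
      show "\<forall>\<^sub>F t in at_right 0. a \<bullet> b - snd m - s \<bullet> d / 2 \<le> t * (d \<bullet> d / 4)"
        unfolding eventually_at_right_field by (intro exI[of _ 1] conjI allI impI step) auto
    qed simp
    with \<open>g m \<le> 0\<close> show ?thesis
      by (simp add: g_def s_def[symmetric] d_def inner_diff_left inner_diff_right inner_add_left inner_add_right inner_commute
            field_simps)
  qed
  then show ?thesis by blast
qed simp

lemma diameter_balls:
  fixes P :: "('a::euclidean_space \<times> 'a) set"
  assumes anti: "\<And>a b a' b'. (a, b) \<in> P \<Longrightarrow> (a', b') \<in> P \<Longrightarrow> (a - a') \<bullet> (b - b') \<le> 0"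
  shows "\<exists>x. \<forall>(a, b)\<in>P. (x - a) \<bullet> (x - b) \<le> 0"
proof (cases "P = {}")
  case False
  then obtain p where p: "p \<in> P" by blast
  define C where "C q = {x. (x - fst q) \<bullet> (x - snd q) \<le> 0}" for q :: "'a \<times> 'a"
  have closed: "closed (C q)" for q
    unfolding C_def by (intro closed_Collect_le continuous_intros)
  have "C p \<subseteq> cball (fst p) (norm (snd p - fst p))"
  proof
    fix x assume "x \<in> C p"
    hence "(norm (x - fst p))\<^sup>2 \<le> (x - fst p) \<bullet> (snd p - fst p)"
      by (simp add: C_def power2_norm_eq_inner inner_diff_left inner_diff_right)
    also have "\<dots> \<le> norm (x - fst p) * norm (snd p - fst p)"
      by (rule norm_cauchy_schwarz)
    finally have "norm (x - fst p) \<le> norm (snd p - fst p)"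
      by (cases "x = fst p") (auto simp: power2_eq_square)
    thus "x \<in> cball (fst p) (norm (snd p - fst p))"
      by (simp add: dist_norm norm_minus_commute)
  qed
  hence "compact (C p)"
    using closed bounded_subset[OF bounded_cball] by (auto simp: compact_eq_bounded_closed)
  hence "C p \<inter> \<Inter> (C ` P) \<noteq> {}"
  proof (rule compact_imp_fip_image)
    fix P' assume P': "finite P'" "P' \<subseteq> P"
    have "\<exists>x. \<forall>(a, b)\<in>insert p P'. (x - a) \<bullet> (x - b) \<le> 0"
      using P' p by (intro diameter_balls_finite anti) auto
    thus "C p \<inter> \<Inter> (C ` P') \<noteq> {}" by (fastforce simp: C_def)
  qed (rule closed)
  thus ?thesis by (fastforce simp: C_def)
qed simp

text \<open>A point of the product space that is monotonically related to the whole graph belongs to it.\<close>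

lemma maximal_monotone_memI:
  assumes "maximal_monotone T"
    and "\<And>y v. v \<in> T y \<Longrightarrow> 0 \<le> (p - y) \<bullet> (u - v)"
  shows "u \<in> T p"
proof -
  define S where "S q = T q \<union> (if q = p then {u} else {})" for q
  have mono: "\<And>x y u v. u \<in> T x \<Longrightarrow> v \<in> T y \<Longrightarrow> 0 \<le> (x - y) \<bullet> (u - v)"
    using assms(1) by (auto simp: maximal_monotone_def monotone_operator_def gph_def)
  have flip: "(x - y) \<bullet> (u - v) = (y - x) \<bullet> (v - u)" for x y u v :: 'a
    by (simp add: inner_diff_left inner_diff_right)
  have "0 \<le> (y - p) \<bullet> (v - u)" if "v \<in> T y" for y v
    using assms(2)[OF that] flip by metis
  hence "monotone_operator S"
    using mono assms(2) by (auto simp: monotone_operator_def gph_def S_def split: if_splits)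
  moreover have "gph T \<subseteq> gph S" by (auto simp: gph_def S_def)
  ultimately have "gph S = gph T" using assms(1) by (simp add: maximal_monotone_def)
  moreover have "(p, u) \<in> gph S" by (simp add: gph_def S_def)
  ultimately show ?thesis by (simp add: gph_def)
qed

lemma maximal_monotoneD:
  assumes "maximal_monotone T" "u \<in> T x" "v \<in> T y"
  shows "0 \<le> (x - y) \<bullet> (u - v)"
  using assms by (auto simp: maximal_monotone_def monotone_operator_def gph_def)

text \<open>Surjectivity of \<open>I + \<gamma> T\<close>: the balls with diameters \<open>[y, w - \<gamma> v]\<close> for \<open>v \<in> T y\<close> have a
  common point \<open>p\<close>, which means that \<open>(w - p) / \<gamma>\<close> is monotonically related to the graph at \<open>p\<close>.\<close>

theorem Minty:
  fixes T :: "'a::euclidean_space operator"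
  assumes T: "maximal_monotone T" and \<gamma>: "\<gamma> > 0"
  shows "\<exists>p. \<exists>u\<in>T p. w = p + \<gamma> *\<^sub>R u"
proof -
  define P where "P = {(y, w - \<gamma> *\<^sub>R v) |y v. v \<in> T y}"
  have "\<exists>x. \<forall>(a, b)\<in>P. (x - a) \<bullet> (x - b) \<le> 0"
  proof (rule diameter_balls)
    fix a b a' b' assume "(a, b) \<in> P" "(a', b') \<in> P"
    then obtain v v' where v: "v \<in> T a" "v' \<in> T a'" "b = w - \<gamma> *\<^sub>R v" "b' = w - \<gamma> *\<^sub>R v'"
      by (auto simp: P_def)
    have "(a - a') \<bullet> (b - b') = - (\<gamma> * ((a - a') \<bullet> (v - v')))"
      by (simp add: v algebra_simps inner_diff_left inner_diff_right)
    thus "(a - a') \<bullet> (b - b') \<le> 0"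
      using maximal_monotoneD[OF T v(1,2)] \<gamma> by simp
  qed
  then obtain p where p: "\<And>y v. v \<in> T y \<Longrightarrow> (p - y) \<bullet> (p - (w - \<gamma> *\<^sub>R v)) \<le> 0"
    by (fastforce simp: P_def)
  have "(1/\<gamma>) *\<^sub>R (w - p) \<in> T p"
  proof (rule maximal_monotone_memI[OF T])
    fix y v assume "v \<in> T y"
    have "(1/\<gamma>) *\<^sub>R (w - p) - v = (- 1/\<gamma>) *\<^sub>R (p - (w - \<gamma> *\<^sub>R v))"
      using \<gamma> by (simp add: scaleR_right_diff_distrib scaleR_right_distrib)
    hence "(p - y) \<bullet> ((1/\<gamma>) *\<^sub>R (w - p) - v) = - ((p - y) \<bullet> (p - (w - \<gamma> *\<^sub>R v))) / \<gamma>"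
      by (simp only: inner_scaleR_right) simp
    thus "0 \<le> (p - y) \<bullet> ((1/\<gamma>) *\<^sub>R (w - p) - v)"
      using p[OF \<open>v \<in> T y\<close>] \<gamma> by (simp add: divide_nonpos_pos)
  qed
  thus ?thesis using \<gamma> by (intro exI[of _ p] bexI[of _ "(1/\<gamma>) *\<^sub>R (w - p)"]) auto
qed

lemma monotone_sum_scaled_inj:
  assumes T: "maximal_monotone T" and \<gamma>: "\<gamma> > 0"
    and "u \<in> T p" "v \<in> T q" "p + \<gamma> *\<^sub>R u = q + \<gamma> *\<^sub>R v"
  shows "p = q"
proof -
  have "\<gamma> *\<^sub>R (u - v) = q - p" using assms(5) by (simp add: algebra_simps)
  hence "\<gamma> * ((p - q) \<bullet> (u - v)) = (p - q) \<bullet> (q - p)"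
    by (metis inner_scaleR_right)
  also have "\<dots> = - ((p - q) \<bullet> (p - q))" by (simp add: inner_diff_left inner_diff_right)
  finally have "(p - q) \<bullet> (p - q) \<le> 0"
    using maximal_monotoneD[OF assms(1,3,4)] \<gamma>
    by (metis mult_nonneg_nonneg less_imp_le neg_0_le_iff_le)
  hence "(p - q) \<bullet> (p - q) = 0" using inner_ge_zero[of "p - q"] by linarith
  thus ?thesis by simp
qed

lemma resolvent_eq_iff:
  fixes T :: "'a::euclidean_space operator"
  assumes T: "maximal_monotone T" and \<gamma>: "\<gamma> > 0"
  shows "resolvent \<gamma> T w = p \<longleftrightarrow> (\<exists>u\<in>T p. w = p + \<gamma> *\<^sub>R u)"
proof -
  have op: "resolvent_op \<gamma> T w = {p. \<exists>u\<in>T p. w = p + \<gamma> *\<^sub>R u}"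
    by (auto simp: resolvent_op_def op_inverse_def op_add_def op_id_def op_scaleR_def)
  obtain q where q: "\<exists>u\<in>T q. w = q + \<gamma> *\<^sub>R u" using Minty[OF T \<gamma>] by blast
  hence "resolvent_op \<gamma> T w = {q}"
    unfolding op using monotone_sum_scaled_inj[OF T \<gamma>] by blast
  moreover from this op have "p = q \<longleftrightarrow> (\<exists>u\<in>T p. w = p + \<gamma> *\<^sub>R u)" by blast
  ultimately show ?thesis by (auto simp: resolvent_def)
qed

section \<open>The Douglas--Rachford map\<close>

text \<open>One evaluation of the Douglas--Rachford map at \<open>x\<close>, with the intermediate points \<open>z\<close>, \<open>y\<close>
  and the elements \<open>b \<in> B z\<close>, \<open>a \<in> A y\<close> that certify the two resolvent evaluations.\<close>

definition DR_step :: "real \<Rightarrow> 'a::real_vector operator \<Rightarrow> 'a operator \<Rightarrow> 'a \<Rightarrow> 'a \<Rightarrow> 'a \<Rightarrow> 'a \<Rightarrow> 'a \<Rightarrow> bool"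
  where "DR_step \<gamma> A B x z b y a \<longleftrightarrow>
    b \<in> B z \<and> x = z + \<gamma> *\<^sub>R b \<and> a \<in> A y \<and> 2 *\<^sub>R z - x = y + \<gamma> *\<^sub>R a"

lemma DR_map_eq:
  "DR_map \<gamma> A B x =
     x + resolvent \<gamma> A (2 *\<^sub>R resolvent \<gamma> B x - x) - resolvent \<gamma> B x"
proof -
  have "2 *\<^sub>R p - (2 *\<^sub>R q - x) + x = 2 *\<^sub>R (x + p - q)" for p q :: 'a
    by (simp add: algebra_simps scaleR_2)
  thus ?thesis by (simp add: DR_map_def reflected_resolvent_def)
qed

lemma resolvent_nonexpansive:
  fixes T :: "'a::euclidean_space operator"
  assumes T: "maximal_monotone T" and \<gamma>: "\<gamma> > 0"
  shows "norm (resolvent \<gamma> T v - resolvent \<gamma> T w) \<le> norm (v - w)"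
proof -
  let ?p = "resolvent \<gamma> T v" and ?q = "resolvent \<gamma> T w"
  obtain a where a: "a \<in> T ?p" "v = ?p + \<gamma> *\<^sub>R a"
    using resolvent_eq_iff[OF T \<gamma>] by blast
  obtain b where b: "b \<in> T ?q" "w = ?q + \<gamma> *\<^sub>R b"
    using resolvent_eq_iff[OF T \<gamma>] by blast
  have vw: "v - w = (?p - ?q) + \<gamma> *\<^sub>R (a - b)"
    using a(2) b(2) by (simp add: algebra_simps)
  have "(?p - ?q) \<bullet> (v - w) = (norm (?p - ?q))\<^sup>2 + \<gamma> * ((?p - ?q) \<bullet> (a - b))"
    unfolding vw by (simp add: inner_add_right power2_norm_eq_inner)
  hence "(norm (?p - ?q))\<^sup>2 \<le> (?p - ?q) \<bullet> (v - w)"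
    using maximal_monotoneD[OF T a(1) b(1)] \<gamma> by simp
  also have "\<dots> \<le> norm (?p - ?q) * norm (v - w)" by (rule norm_cauchy_schwarz)
  finally show ?thesis
    by (cases "?p = ?q") (auto simp: power2_eq_square)
qed

lemma continuous_resolvent:
  fixes T :: "'a::euclidean_space operator"
  assumes "maximal_monotone T" "\<gamma> > 0"
  shows "continuous_on UNIV (resolvent \<gamma> T)"
proof -
  have "1-lipschitz_on UNIV (resolvent \<gamma> T)"
    using resolvent_nonexpansive[OF assms] by (auto intro!: lipschitz_onI simp: dist_norm)
  thus ?thesis by (rule lipschitz_on_continuous_on)
qed

text \<open>Two maximal monotone operators on a Euclidean space and a positive step size; within this
  context \<open>T\<close> is the Douglas--Rachford map and \<open>zeros\<close> the solution set of \<open>0 \<in> A x + B x\<close>.\<close>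

locale DR_splitting =
  fixes A B :: "'a::euclidean_space operator" and \<gamma> :: real
  assumes A: "maximal_monotone A" and B: "maximal_monotone B" and \<gamma>: "\<gamma> > 0"
begin

abbreviation "T \<equiv> DR_map \<gamma> A B"
abbreviation "zeros \<equiv> op_inverse (op_add A B) 0"

lemma resolvents_step:
  assumes "z = resolvent \<gamma> B x" "y = resolvent \<gamma> A (2 *\<^sub>R z - x)"
  obtains a b where "DR_step \<gamma> A B x z b y a"
proof -
  obtain b where "b \<in> B z" "x = z + \<gamma> *\<^sub>R b"
    using resolvent_eq_iff[OF B \<gamma>] assms(1) by blast
  moreover obtain a where "a \<in> A y" "2 *\<^sub>R z - x = y + \<gamma> *\<^sub>R a"
    using resolvent_eq_iff[OF A \<gamma>] assms(2) by blast
  ultimately show thesis using that unfolding DR_step_def by blast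
qed

lemma step_resolvents:
  assumes "DR_step \<gamma> A B x z b y a"
  shows "resolvent \<gamma> B x = z" "resolvent \<gamma> A (2 *\<^sub>R z - x) = y" "T x = x + y - z"
proof -
  show 1: "resolvent \<gamma> B x = z" and 2: "resolvent \<gamma> A (2 *\<^sub>R z - x) = y"
    using assms resolvent_eq_iff[OF A \<gamma>] resolvent_eq_iff[OF B \<gamma>] unfolding DR_step_def by blast+
  show "T x = x + y - z" by (simp add: DR_map_eq 1 2)
qed

lemma continuous_T: "continuous_on UNIV T"
proof -
  have "continuous_on UNIV (\<lambda>x. x + resolvent \<gamma> A (2 *\<^sub>R resolvent \<gamma> B x - x) - resolvent \<gamma> B x)"
    by (intro continuous_intros continuous_on_compose2[OF continuous_resolvent[OF A \<gamma>]]
        continuous_resolvent[OF B \<gamma>]) auto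
  thus ?thesis by (simp add: DR_map_eq[abs_def])
qed

text \<open>With \<open>d\<close>, \<open>e\<close>, \<open>f\<close> the differences of the \<open>x\<close>-, \<open>y\<close>- and \<open>z\<close>-points, the inner product is
  exactly the sum of the two monotonicity expressions of \<open>B\<close> and \<open>A\<close>, each multiplied by \<open>\<gamma>\<close>.\<close>

lemma firmly_nonexpansive: "0 \<le> (T x - T w) \<bullet> ((x - T x) - (w - T w))"
proof -
  obtain z b y a where s: "DR_step \<gamma> A B x z b y a" by (rule resolvents_step[OF refl refl])
  obtain z' b' y' a' where s': "DR_step \<gamma> A B w z' b' y' a'" by (rule resolvents_step[OF refl refl])
  define d e f where "d = x - w" and "e = y - y'" and "f = z - z'"
  have "\<gamma> *\<^sub>R b = x - z" "\<gamma> *\<^sub>R b' = w - z'"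
    "\<gamma> *\<^sub>R a = 2 *\<^sub>R z - x - y" "\<gamma> *\<^sub>R a' = 2 *\<^sub>R z' - w - y'"
    using s s' unfolding DR_step_def by (metis add_diff_cancel_left')+
  hence b: "\<gamma> *\<^sub>R (b - b') = d - f" and a: "\<gamma> *\<^sub>R (a - a') = 2 *\<^sub>R f - d - e"
    by (simp_all add: scaleR_right_diff_distrib d_def e_def f_def)
  have "0 \<le> f \<bullet> (b - b')" "0 \<le> e \<bullet> (a - a')"
    using s s' maximal_monotoneD[OF A, of a y a' y'] maximal_monotoneD[OF B, of b z b' z']
    by (auto simp: DR_step_def e_def f_def)
  hence "0 \<le> f \<bullet> (\<gamma> *\<^sub>R (b - b'))" "0 \<le> e \<bullet> (\<gamma> *\<^sub>R (a - a'))"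
    using \<gamma> by simp_all
  hence "0 \<le> f \<bullet> (d - f) + e \<bullet> (2 *\<^sub>R f - d - e)"
    unfolding a b by (rule add_nonneg_nonneg)
  also have "\<dots> = (d + e - f) \<bullet> (f - e)"
    by (simp add: inner_add_left inner_diff_left inner_diff_right
        inner_commute[of e d] inner_commute[of f d] inner_commute[of f e])
  also have "d + e - f = T x - T w"
    by (simp add: step_resolvents(3)[OF s] step_resolvents(3)[OF s'] d_def e_def f_def)
  also have "f - e = (x - T x) - (w - T w)"
    by (simp add: step_resolvents(3)[OF s] step_resolvents(3)[OF s'] d_def e_def f_def)
  finally show ?thesis .
qed

lemma relaxed_step_Fejer:
  assumes w: "w \<in> Fix T" and l: "0 \<le> l"
  shows "(norm (x + l *\<^sub>R (T x - x) - w))\<^sup>2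
         \<le> (norm (x - w))\<^sup>2 - l * (2 - l) * (norm (T x - x))\<^sup>2"
proof -
  have "0 \<le> (T x - w) \<bullet> (x - T x)"
    using firmly_nonexpansive[of x w] w by (simp add: Fix_def)
  moreover have "(T x - w) \<bullet> (x - T x) = - ((x - w) \<bullet> (T x - x)) - (norm (T x - x))\<^sup>2"
    by (simp add: power2_norm_eq_inner inner_diff_left inner_diff_right inner_commute)
  ultimately have "l * ((x - w) \<bullet> (T x - x)) \<le> l * (- (norm (T x - x))\<^sup>2)"
    using l by (intro mult_left_mono) auto
  moreover have "(norm (x + l *\<^sub>R (T x - x) - w))\<^sup>2
      = (norm (x - w))\<^sup>2 + 2 * l * ((x - w) \<bullet> (T x - x)) + l\<^sup>2 * (norm (T x - x))\<^sup>2"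
  proof -
    have "x + l *\<^sub>R (T x - x) - w = (x - w) + l *\<^sub>R (T x - x)" by simp
    thus ?thesis
      by (simp only: power2_norm_eq_inner)
        (simp add: inner_add_left inner_add_right inner_commute power2_eq_square)
  qed
  ultimately show ?thesis by (simp add: power2_eq_square algebra_simps)
qed

text \<open>This is the monotonicity of the residual along the iteration, which lets the divergence of
  the weight sum alone force the residuals to \<open>0\<close>.\<close>

lemma relaxed_step_residual:
  fixes x :: 'a
  assumes l: "0 \<le> l" "l \<le> 2"
  defines "x' \<equiv> x + l *\<^sub>R (T x - x)"
  shows "norm (T x' - x') \<le> norm (T x - x)"
proof -
  define r r' where "r = T x - x" and "r' = T x' - x'"
  have "0 \<le> (T x - T x') \<bullet> ((x - T x) - (x' - T x'))" by (rule firmly_nonexpansive)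
  also have "T x - T x' = (1 - l) *\<^sub>R r - r'"
    by (simp add: r_def r'_def x'_def algebra_simps)
  also have "(x - T x) - (x' - T x') = r' - r" by (simp add: r_def r'_def)
  finally have "(norm r')\<^sup>2 \<le> (2 - l) * (r' \<bullet> r) + (l - 1) * (norm r)\<^sup>2"
    by (simp add: power2_norm_eq_inner inner_diff_left inner_diff_right inner_commute algebra_simps)
  also have "\<dots> \<le> (2 - l) * (((norm r')\<^sup>2 + (norm r)\<^sup>2) / 2) + (l - 1) * (norm r)\<^sup>2"
  proof -
    have "0 \<le> (r' - r) \<bullet> (r' - r)" by simp
    hence "r' \<bullet> r \<le> ((norm r')\<^sup>2 + (norm r)\<^sup>2) / 2"
      by (simp add: power2_norm_eq_inner inner_diff_left inner_diff_right inner_commute)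
    thus ?thesis using l by (intro add_right_mono mult_left_mono) auto
  qed
  finally have "l * (norm r')\<^sup>2 \<le> l * (norm r)\<^sup>2" by (simp add: field_simps)
  thus ?thesis
    by (cases "l = 0") (use l in \<open>auto simp: r_def r'_def x'_def power_mono_iff\<close>)
qed

lemma zero_fixed_point:
  assumes "a \<in> A p" "b \<in> B p" "a + b = 0"
  shows "p + \<gamma> *\<^sub>R b \<in> Fix T"
proof -
  have "a = - b" using assms(3) by (simp add: eq_neg_iff_add_eq_0)
  hence "DR_step \<gamma> A B (p + \<gamma> *\<^sub>R b) p b p a"
    using assms by (simp add: DR_step_def scaleR_2)
  from step_resolvents(3)[OF this] show ?thesis by (simp add: Fix_def)
qed

lemma fixed_point_zero:
  assumes "x \<in> Fix T"
  shows "resolvent \<gamma> B x \<in> zeros"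
proof -
  obtain z b y a where s: "DR_step \<gamma> A B x z b y a" by (rule resolvents_step[OF refl refl])
  from step_resolvents[OF s] assms have z: "resolvent \<gamma> B x = z" and yz: "y = z"
    by (auto simp: Fix_def)
  have "\<gamma> *\<^sub>R (a + b) = 0" using s unfolding DR_step_def yz by (auto simp: algebra_simps scaleR_2)
  hence "0 = a + b" using \<gamma> by simp
  thus ?thesis using s unfolding z op_inverse_def op_add_def DR_step_def yz by blast
qed

text \<open>Krasnoselskii--Mann convergence for the relaxed iteration of \<open>T\<close>.\<close>

lemma relaxed_iteration_converges:
  assumes "Fix T \<noteq> {}"
    and l: "\<And>k. 0 \<le> l k \<and> l k \<le> 2"
    and div: "filterlim (\<lambda>n. \<Sum>k<n. l k * (2 - l k)) at_top sequentially"
    and x: "\<And>k. x (Suc k) = x k + l k *\<^sub>R (T (x k) - x k)"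
  obtains xs where "xs \<in> Fix T" "x \<longlonglongrightarrow> xs"
proof -
  define d where "d k = norm (T (x k) - x k)" for k
  have dec: "decseq d"
    using relaxed_step_residual l unfolding d_def by (intro decseq_SucI) (simp add: x)
  have Fejer: "(norm (x (Suc k) - w))\<^sup>2 \<le> (norm (x k - w))\<^sup>2 - l k * (2 - l k) * (d k)\<^sup>2"
    if "w \<in> Fix T" for w k
    unfolding x d_def using relaxed_step_Fejer[OF that] l by blast
  have c: "0 \<le> l k * (2 - l k)" for k using l[of k] by simp
  have mono: "decseq (\<lambda>k. norm (x k - w))" if "w \<in> Fix T" for w
  proof (rule decseq_SucI)
    fix k
    have "0 \<le> l k * (2 - l k) * (d k)\<^sup>2" using c by simp
    with Fejer[OF that, of k] have "(norm (x (Suc k) - w))\<^sup>2 \<le> (norm (x k - w))\<^sup>2" by linarith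
    thus "norm (x (Suc k) - w) \<le> norm (x k - w)" by (simp add: power_mono_iff)
  qed
  obtain w where w: "w \<in> Fix T" using assms(1) by blast
  \<comment> \<open>Telescoping the Fejer inequality, and bounding each \<open>d k\<close> below by \<open>d n\<close>.\<close>
  have sum: "(\<Sum>k<n. l k * (2 - l k)) * (d n)\<^sup>2 \<le> (norm (x 0 - w))\<^sup>2" for n
  proof -
    have tel: "(\<Sum>k<n. l k * (2 - l k) * (d k)\<^sup>2) \<le> (norm (x 0 - w))\<^sup>2 - (norm (x n - w))\<^sup>2"
      using Fejer[OF w] by (induction n) (simp_all, smt (verit))
    have "(\<Sum>k<n. l k * (2 - l k)) * (d n)\<^sup>2 \<le> (\<Sum>k<n. l k * (2 - l k) * (d k)\<^sup>2)"
      unfolding sum_distrib_right using c decseqD[OF dec]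
      by (intro sum_mono mult_left_mono power_mono) (auto simp: d_def)
    with tel show ?thesis by (smt (verit) zero_le_power2)
  qed
  have d0: "d \<longlonglongrightarrow> 0"
  proof (rule LIMSEQ_I)
    fix e :: real assume e: "0 < e"
    obtain n where n: "(norm (x 0 - w))\<^sup>2 / e\<^sup>2 + 1 \<le> (\<Sum>k<n. l k * (2 - l k))"
      using div by (auto simp: filterlim_at_top eventually_sequentially)
    have "d n < e"
    proof (rule ccontr)
      assume "\<not> d n < e"
      hence "e\<^sup>2 \<le> (d n)\<^sup>2" using e by (intro power_mono) auto
      hence "((norm (x 0 - w))\<^sup>2 / e\<^sup>2 + 1) * e\<^sup>2 \<le> (\<Sum>k<n. l k * (2 - l k)) * (d n)\<^sup>2"
        using n by (intro mult_mono) (auto intro!: sum_nonneg simp: l)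
      also have "((norm (x 0 - w))\<^sup>2 / e\<^sup>2 + 1) * e\<^sup>2 = (norm (x 0 - w))\<^sup>2 + e\<^sup>2"
        using e by (simp add: distrib_right)
      finally show False using sum[of n] zero_less_power[OF e, of 2] by linarith
    qed
    thus "\<exists>no. \<forall>n\<ge>no. norm (d n - 0) < e"
      using decseqD[OF dec] by (intro exI[of _ n]) (smt (verit) d_def norm_ge_zero real_norm_def)
  qed
  have "bounded (range x)"
  proof (rule bounded_subset[OF bounded_cball])
    show "range x \<subseteq> cball w (norm (x 0 - w))"
      using decseqD[OF mono[OF w], of 0] by (auto simp: dist_norm norm_minus_commute)
  qed
  then obtain xs s where s: "strict_mono s" "(x \<circ> s) \<longlonglongrightarrow> xs"
    using bounded_imp_convergent_subsequence by blast
  have "(\<lambda>k. norm (T (x (s k)) - x (s k))) \<longlonglongrightarrow> norm (T xs - xs)"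
  proof (intro tendsto_intros)
    show xs: "(\<lambda>k. x (s k)) \<longlonglongrightarrow> xs" using s(2) by (simp add: o_def)
    show "(\<lambda>k. T (x (s k))) \<longlonglongrightarrow> T xs"
      using continuous_on_tendsto_compose[OF continuous_T xs] by simp
  qed
  moreover have "(\<lambda>k. norm (T (x (s k)) - x (s k))) \<longlonglongrightarrow> 0"
    using LIMSEQ_subseq_LIMSEQ[OF d0 s(1)] by (simp add: o_def d_def)
  ultimately have "norm (T xs - xs) = 0" by (rule LIMSEQ_unique)
  hence fp: "xs \<in> Fix T" by (simp add: Fix_def)
  have "(\<lambda>k. norm (x k - xs)) \<longlonglongrightarrow> 0"
  proof (rule LIMSEQ_I)
    fix e :: real assume "0 < e"
    then obtain n where n: "norm (x (s n) - xs) < e"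
      using LIMSEQ_D[OF s(2)] by fastforce
    thus "\<exists>no. \<forall>n\<ge>no. norm (norm (x n - xs) - 0) < e"
      using decseqD[OF mono[OF fp]] by (intro exI[of _ "s n"]) (smt (verit) norm_ge_zero real_norm_def)
  qed
  hence "x \<longlonglongrightarrow> xs" by (simp add: tendsto_norm_zero_iff LIM_zero_iff)
  with fp that show thesis by blast
qed

end

section \<open>Error bounds and local linear convergence\<close>

lemma le_infdistI:
  assumes "S \<noteq> {}" "\<And>s. s \<in> S \<Longrightarrow> c \<le> norm (x - s)"
  shows "c \<le> infdist x S"
  using assms by (auto simp: infdist_notempty dist_norm intro!: cINF_greatest)

lemma infdist_le_norm:
  assumes "s \<in> S"
  shows "infdist x S \<le> norm (x - s)"
  using infdist_le[OF assms, of x] by (simp add: dist_norm)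

lemma dist_set_eq_infdist:
  assumes "S \<noteq> {}"
  shows "dist_set x S = ereal (infdist x S)"
proof -
  have "bdd_below ((\<lambda>s. norm (x - s)) ` S)" by (rule bdd_belowI[of _ 0]) auto
  from ereal_Inf'[OF this] show ?thesis
    using assms by (simp add: dist_set_def infdist_notempty dist_norm image_image)
qed

text \<open>The form in which subregularity is used: along a sequence tending to the reference point,
  every element of the value of the operator eventually bounds the distance to the solution set.
  The solution set is nonempty, so \<^const>\<open>infdist\<close> may replace \<^const>\<open>dist_set\<close>.\<close>

lemma metrically_subregular_eventually:
  assumes "metrically_subregular F xb yb \<kappa>" and p: "p \<longlonglongrightarrow> xb"
  shows "\<forall>\<^sub>F k in sequentially. \<forall>u\<in>F (p k). infdist (p k) (op_inverse F yb) \<le> \<kappa> * norm (yb - u)"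
proof -
  obtain U where "open U" "xb \<in> U"
    and U: "\<And>x. x \<in> U \<Longrightarrow> dist_set x (op_inverse F yb) \<le> ereal \<kappa> * dist_set yb (F x)"
    using assms(1) unfolding metrically_subregular_def by blast
  have \<kappa>: "0 < \<kappa>" and ne: "op_inverse F yb \<noteq> {}"
    using assms(1) by (auto simp: metrically_subregular_def gph_def op_inverse_def)
  have "\<forall>\<^sub>F k in sequentially. p k \<in> U"
    using p \<open>open U\<close> \<open>xb \<in> U\<close> by (rule topological_tendstoD)
  thus ?thesis
  proof eventually_elim
    case (elim k)
    show ?case
    proof
      fix u assume "u \<in> F (p k)"
      have "ereal (infdist (p k) (op_inverse F yb)) \<le> ereal \<kappa> * dist_set yb (F (p k))"
        using U[OF elim] ne by (simp add: dist_set_eq_infdist)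
      also have "\<dots> \<le> ereal \<kappa> * ereal (norm (yb - u))"
        using \<kappa> \<open>u \<in> F (p k)\<close> unfolding dist_set_def
        by (intro ereal_mult_left_mono INF_lower) auto
      finally show "infdist (p k) (op_inverse F yb) \<le> \<kappa> * norm (yb - u)" by simp
    qed
  qed
qed

lemma power2_norm_diff_le:
  fixes v w :: "'a::real_inner"
  assumes "0 \<le> v \<bullet> w"
  shows "(norm (v - w))\<^sup>2 \<le> (norm v)\<^sup>2 + (norm w)\<^sup>2"
  using assms by (simp add: power2_norm_eq_inner inner_diff_left inner_diff_right inner_commute)

context DR_splitting
begin

lemma relaxed_step_contraction:
  assumes ne: "Fix T \<noteq> {}" and l: "0 \<le> l" "l \<le> 2" and C: "1 \<le> C"
    and err: "infdist x (Fix T) \<le> C * norm (T x - x)"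
  shows "infdist (x + l *\<^sub>R (T x - x)) (Fix T)
         \<le> sqrt (1 - l * (2 - l) / C\<^sup>2) * infdist x (Fix T)"
proof -
  define D D' r where "D = infdist x (Fix T)" and "D' = infdist (x + l *\<^sub>R (T x - x)) (Fix T)"
    and "r = norm (T x - x)"
  have c: "0 \<le> l * (2 - l)" using l by simp
  have "sqrt (D'\<^sup>2 + l * (2 - l) * r\<^sup>2) \<le> D"
    unfolding D_def
  proof (rule le_infdistI[OF ne])
    fix w assume w: "w \<in> Fix T"
    have "D'\<^sup>2 \<le> (norm (x + l *\<^sub>R (T x - x) - w))\<^sup>2"
      unfolding D'_def using infdist_le_norm[OF w] by (intro power_mono infdist_nonneg)
    also have "\<dots> \<le> (norm (x - w))\<^sup>2 - l * (2 - l) * r\<^sup>2"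
      unfolding r_def by (rule relaxed_step_Fejer[OF w l(1)])
    finally show "sqrt (D'\<^sup>2 + l * (2 - l) * r\<^sup>2) \<le> norm (x - w)"
      by (intro real_le_lsqrt) auto
  qed
  hence "D'\<^sup>2 + l * (2 - l) * r\<^sup>2 \<le> D\<^sup>2"
    by (rule sqrt_le_D)
  moreover have "l * (2 - l) * (D / C)\<^sup>2 \<le> l * (2 - l) * r\<^sup>2"
    using c C err infdist_nonneg[of x "Fix T"]
    by (intro mult_left_mono power_mono) (auto simp: D_def r_def field_simps)
  ultimately have "D'\<^sup>2 \<le> (1 - l * (2 - l) / C\<^sup>2) * D\<^sup>2"
    by (simp add: power_divide algebra_simps)
  hence "D' \<le> sqrt ((1 - l * (2 - l) / C\<^sup>2) * D\<^sup>2)" by (rule real_le_rsqrt)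
  thus ?thesis
    using infdist_nonneg[of x "Fix T"] by (simp add: D_def D'_def real_sqrt_mult)
qed

text \<open>A zero \<open>p\<close> of \<open>A + B\<close> is turned into a fixed point of the Douglas--Rachford map, so a bound
  on the distance of \<open>x\<close> to these fixed points that is affine in the distance of some \<open>q\<close> to \<open>p\<close>
  yields one in terms of the distance of \<open>q\<close> to the set of zeros.\<close>

lemma infdist_Fix_le:
  assumes ne: "zeros \<noteq> {}" and c: "0 < c"
    and bound: "\<And>p a b. a \<in> A p \<Longrightarrow> b \<in> B p \<Longrightarrow> a = - b \<Longrightarrow>
      norm (x - (p + \<gamma> *\<^sub>R b)) \<le> e + c * norm (q - p)"
  shows "infdist x (Fix T) \<le> e + c * infdist q zeros"
proof -
  have "(infdist x (Fix T) - e) / c \<le> infdist q zeros"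
  proof (rule le_infdistI[OF ne])
    fix p assume "p \<in> zeros"
    then obtain a b where ab: "a \<in> A p" "b \<in> B p" "a + b = 0"
      by (auto simp: op_inverse_def op_add_def)
    hence "infdist x (Fix T) \<le> norm (x - (p + \<gamma> *\<^sub>R b))"
      by (intro infdist_le_norm zero_fixed_point)
    also have "\<dots> \<le> e + c * norm (q - p)"
      using ab by (intro bound) (auto simp: eq_neg_iff_add_eq_0)
    finally show "(infdist x (Fix T) - e) / c \<le> norm (q - p)"
      using c by (simp add: field_simps)
  qed
  thus ?thesis using c by (simp add: field_simps)
qed

text \<open>With \<open>g = A y - A p\<close> one has \<open>x - (p - \<gamma> A p) = 2 (z - y) + ((y - p) - \<gamma> g)\<close>, and monotonicity
  of \<open>A\<close> bounds the norm of the second term by \<open>sqrt (1 + \<gamma>\<^sup>2 L\<^sup>2) \<parallel>y - p\<parallel>\<close> instead of the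
  \<open>(1 + \<gamma> L) \<parallel>y - p\<parallel>\<close> that the triangle inequality would give.\<close>

lemma error_bound_A:
  assumes s: "DR_step \<gamma> A B x z b y a"
    and f: "\<And>v. A v = {f v}" "L-lipschitz_on UNIV f"
    and ne: "zeros \<noteq> {}" and \<kappa>: "0 < \<kappa>"
    and sub: "\<And>u. u \<in> op_add A B z \<Longrightarrow> infdist z zeros \<le> \<kappa> * norm u"
  shows "infdist x (Fix T)
         \<le> (2 + sqrt (1 + \<gamma>\<^sup>2 * L\<^sup>2) * (1 + \<kappa> * (1 / \<gamma> + L))) * norm (T x - x)"
proof -
  define c where "c = sqrt (1 + \<gamma>\<^sup>2 * L\<^sup>2)"
  define r where "r = norm (y - z)"
  have c: "0 < c" unfolding c_def by (simp add: add_pos_nonneg)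
  have lip: "norm (f u - f v) \<le> L * norm (u - v)" for u v
    using lipschitz_onD[OF f(2), of u v] by (simp add: dist_norm)
  have s': "b \<in> B z" "x = z + \<gamma> *\<^sub>R b" "a = f y" "2 *\<^sub>R z - x = y + \<gamma> *\<^sub>R a"
    using s by (auto simp: DR_step_def f)
  have "\<gamma> *\<^sub>R (b + f y) = z - y"
    using s' by (auto simp: algebra_simps scaleR_2)
  moreover have "b + f y = (1/\<gamma>) *\<^sub>R (\<gamma> *\<^sub>R (b + f y))" using \<gamma> by simp
  ultimately have byf: "b + f y = (1/\<gamma>) *\<^sub>R (z - y)" by (simp only:)
  have "infdist z zeros \<le> \<kappa> * norm (f z + b)"
    using s' by (intro sub) (auto simp: op_add_def f)
  also have "f z + b = (f z - f y) + (1/\<gamma>) *\<^sub>R (z - y)"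
    by (simp flip: byf)
  also have "norm \<dots> \<le> L * r + r / \<gamma>"
    using lip[of z y] \<gamma> by (intro norm_triangle_mono) (auto simp: r_def norm_minus_commute)
  finally have z: "infdist z zeros \<le> \<kappa> * (1 / \<gamma> + L) * r"
    using \<kappa> by (simp add: algebra_simps)
  have "infdist x (Fix T) \<le> (2 * r + c * r) + c * infdist z zeros"
  proof (rule infdist_Fix_le[OF ne c])
    fix p a' b' assume "a' \<in> A p" "b' \<in> B p" "a' = - b'"
    hence fp: "b' = - f p" using f by (metis add.inverse_inverse singletonD)
    define g where "g = f y - f p"
    have "0 \<le> (y - p) \<bullet> g"
      unfolding g_def by (rule maximal_monotoneD[OF A]) (auto simp: f)
    hence "(norm ((y - p) - \<gamma> *\<^sub>R g))\<^sup>2 \<le> (norm (y - p))\<^sup>2 + (norm (\<gamma> *\<^sub>R g))\<^sup>2"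
      using \<gamma> by (intro power2_norm_diff_le) simp
    also have "\<dots> = (norm (y - p))\<^sup>2 + \<gamma>\<^sup>2 * (norm g)\<^sup>2" by (simp add: power_mult_distrib)
    also have "\<dots> \<le> (norm (y - p))\<^sup>2 + \<gamma>\<^sup>2 * (L * norm (y - p))\<^sup>2"
      using lip[of y p] by (intro add_left_mono mult_left_mono power_mono) (auto simp: g_def)
    also have "\<dots> = (1 + \<gamma>\<^sup>2 * L\<^sup>2) * (norm (y - p))\<^sup>2" by (simp add: algebra_simps)
    finally have "norm ((y - p) - \<gamma> *\<^sub>R g) \<le> c * norm (y - p)"
      unfolding c_def using real_le_rsqrt by (fastforce simp: real_sqrt_mult)
    also have "\<dots> \<le> c * (r + norm (z - p))"
      using c norm_triangle_ineq[of "y - z" "z - p"] by (intro mult_left_mono) (auto simp: r_def)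
    finally have 1: "norm ((y - p) - \<gamma> *\<^sub>R g) \<le> c * (r + norm (z - p))" .
    have "x - (p + \<gamma> *\<^sub>R b') = 2 *\<^sub>R (z - y) + ((y - p) - \<gamma> *\<^sub>R g)"
    proof -
      have "x = 2 *\<^sub>R z - y - \<gamma> *\<^sub>R f y" using s'(3,4) by (simp add: algebra_simps)
      thus ?thesis by (simp add: fp g_def algebra_simps scaleR_2)
    qed
    also have "norm \<dots> \<le> 2 * r + c * (r + norm (z - p))"
      using 1 by (intro norm_triangle_mono) (auto simp: r_def norm_minus_commute)
    finally show "norm (x - (p + \<gamma> *\<^sub>R b')) \<le> (2 * r + c * r) + c * norm (z - p)"
      by (simp add: algebra_simps)
  qed
  also have "\<dots> \<le> (2 * r + c * r) + c * (\<kappa> * (1 / \<gamma> + L) * r)"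
    using z c by (intro add_left_mono mult_left_mono) auto
  also have "\<dots> = (2 + c * (1 + \<kappa> * (1 / \<gamma> + L))) * r" by (simp add: algebra_simps)
  also have "r = norm (T x - x)" by (simp add: r_def step_resolvents(3)[OF s])
  finally show ?thesis by (simp add: c_def)
qed

text \<open>Here \<open>x - (p + \<gamma> B p) = (z - p) + \<gamma> (B z - B p)\<close>, while monotonicity of \<open>B\<close> bounds the norm of
  \<open>(z - y) / \<gamma> - (B z - B y)\<close>, an element of \<open>A y + B y\<close>.\<close>

lemma error_bound_B:
  assumes s: "DR_step \<gamma> A B x z b y a"
    and f: "\<And>v. B v = {f v}" "L-lipschitz_on UNIV f"
    and ne: "zeros \<noteq> {}" and \<kappa>: "0 < \<kappa>"
    and sub: "\<And>u. u \<in> op_add A B y \<Longrightarrow> infdist y zeros \<le> \<kappa> * norm u"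
  shows "infdist x (Fix T)
         \<le> (1 + \<gamma> * L) * (1 + \<kappa> * sqrt (1 / \<gamma>\<^sup>2 + L\<^sup>2)) * norm (T x - x)"
proof -
  define c where "c = sqrt (1 / \<gamma>\<^sup>2 + L\<^sup>2)"
  define r where "r = norm (y - z)"
  have L: "0 \<le> L" using lipschitz_on_nonneg[OF f(2)] .
  have L1: "0 < 1 + \<gamma> * L" using L \<gamma> by (simp add: add_pos_nonneg)
  have lip: "norm (f u - f v) \<le> L * norm (u - v)" for u v
    using lipschitz_onD[OF f(2), of u v] by (simp add: dist_norm)
  have s': "b = f z" "x = z + \<gamma> *\<^sub>R f z" "a \<in> A y" "2 *\<^sub>R z - x = y + \<gamma> *\<^sub>R a"
    using s by (auto simp: DR_step_def f)
  have "\<gamma> *\<^sub>R (a + f z) = z - y"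
    using s' by (auto simp: algebra_simps scaleR_2)
  moreover have "a + f z = (1/\<gamma>) *\<^sub>R (\<gamma> *\<^sub>R (a + f z))" using \<gamma> by simp
  ultimately have az: "a + f z = (1/\<gamma>) *\<^sub>R (z - y)" by (simp only:)
  define g where "g = f z - f y"
  have "infdist y zeros \<le> \<kappa> * norm (a + f y)"
    using s' by (intro sub) (auto simp: op_add_def f)
  also have "a + f y = (1/\<gamma>) *\<^sub>R (z - y) - g"
    by (simp add: g_def flip: az)
  also have "norm \<dots> \<le> c * r"
  proof -
    have "0 \<le> (z - y) \<bullet> g"
      unfolding g_def by (rule maximal_monotoneD[OF B]) (auto simp: f)
    hence "(norm ((1/\<gamma>) *\<^sub>R (z - y) - g))\<^sup>2 \<le> (norm ((1/\<gamma>) *\<^sub>R (z - y)))\<^sup>2 + (norm g)\<^sup>2"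
      using \<gamma> by (intro power2_norm_diff_le) simp
    also have "\<dots> = (norm (z - y))\<^sup>2 / \<gamma>\<^sup>2 + (norm g)\<^sup>2" by (simp add: power_divide)
    also have "\<dots> \<le> (norm (z - y))\<^sup>2 / \<gamma>\<^sup>2 + (L * norm (z - y))\<^sup>2"
      using lip[of z y] by (intro add_left_mono power_mono) (auto simp: g_def)
    also have "\<dots> = (1 / \<gamma>\<^sup>2 + L\<^sup>2) * r\<^sup>2"
      by (simp add: algebra_simps r_def norm_minus_commute)
    finally show ?thesis
      unfolding c_def using real_le_rsqrt by (fastforce simp: real_sqrt_mult r_def)
  qed
  finally have y: "infdist y zeros \<le> \<kappa> * (c * r)" using \<kappa> by simp
  have "infdist x (Fix T) \<le> (1 + \<gamma> * L) * r + (1 + \<gamma> * L) * infdist y zeros"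
  proof (rule infdist_Fix_le[OF ne L1])
    fix p a' b' assume "a' \<in> A p" "b' \<in> B p" "a' = - b'"
    hence fp: "b' = f p" by (auto simp: f)
    have "x - (p + \<gamma> *\<^sub>R b') = (z - p) + \<gamma> *\<^sub>R (f z - f p)"
      by (simp add: s'(2) fp algebra_simps)
    also have "norm \<dots> \<le> norm (z - p) + \<gamma> * (L * norm (z - p))"
      using lip[of z p] \<gamma> by (intro norm_triangle_mono) (auto intro!: mult_left_mono)
    also have "\<dots> = (1 + \<gamma> * L) * norm (z - p)" by (simp add: algebra_simps)
    also have "\<dots> \<le> (1 + \<gamma> * L) * (r + norm (y - p))"
      using L1 norm_triangle_ineq[of "z - y" "y - p"]
      by (intro mult_left_mono) (auto simp: r_def norm_minus_commute)
    finally show "norm (x - (p + \<gamma> *\<^sub>R b')) \<le> (1 + \<gamma> * L) * r + (1 + \<gamma> * L) * norm (y - p)"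
      by (simp add: algebra_simps)
  qed
  also have "\<dots> \<le> (1 + \<gamma> * L) * r + (1 + \<gamma> * L) * (\<kappa> * (c * r))"
    using y L1 by (intro add_left_mono mult_left_mono) auto
  also have "\<dots> = (1 + \<gamma> * L) * (1 + \<kappa> * c) * r" by (simp add: algebra_simps)
  also have "r = norm (T x - x)" by (simp add: r_def step_resolvents(3)[OF s])
  finally show ?thesis by (simp add: c_def)
qed

end

section \<open>Convergence of the generalized Douglas--Rachford method\<close>

theorem theorem3p3:
  fixes A B :: "'a::euclidean_space operator"
    and F :: "'a operator"
    and T :: "'a \<Rightarrow> 'a"
    and \<gamma> :: real
    and lam :: "nat \<Rightarrow> real"
    and x y z :: "nat \<Rightarrow> 'a"
  assumes "maximal_monotone A" and "maximal_monotone B"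
    and F: "F = op_add A B"
    and "op_inverse F 0 \<noteq> {}"
    and "\<gamma> > 0"
    and "\<And>k. 0 \<le> lam k \<and> lam k \<le> 2"
    and "filterlim (\<lambda>n. \<Sum>k<n. lam k * (2 - lam k)) at_top sequentially"
    and z: "\<And>k. z k = resolvent \<gamma> B (x k)"
    and y: "\<And>k. y k = resolvent \<gamma> A (2 *\<^sub>R z k - x k)"
    and x: "\<And>k. x (Suc k) = x k + lam k *\<^sub>R (y k - z k)"
    and T: "T = DR_map \<gamma> A B"
  shows "\<exists>zs xs.
     (zs \<in> op_inverse F 0 \<and> y \<longlonglongrightarrow> zs \<and> z \<longlonglongrightarrow> zs \<and> xs \<in> Fix T \<and> x \<longlonglongrightarrow> xs \<and>
      (\<forall>w \<in> Fix T. \<forall>k. (norm (x (Suc k) - w))\<^sup>2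
          \<le> (norm (x k - w))\<^sup>2 - lam k * (2 - lam k) * (norm (T (x k) - x k))\<^sup>2)) \<and>
     (\<forall>\<beta> \<kappa>. \<beta> > 0 \<longrightarrow> single_valued_lipschitz (1 / \<beta>) A \<longrightarrow>
        \<kappa> > 0 \<longrightarrow> metrically_subregular F zs 0 \<kappa> \<longrightarrow>
        (\<exists>kb. \<forall>k\<ge>kb. dist_set (x (Suc k)) (Fix T)
          \<le> ereal (sqrt (1 - lam k * (2 - lam k) /
                (2 + sqrt (1 + \<gamma>\<^sup>2 / \<beta>\<^sup>2) * (1 + \<kappa> * (1 / \<gamma> + 1 / \<beta>)))\<^sup>2))
             * dist_set (x k) (Fix T))) \<and>
     (\<forall>\<beta> \<kappa>. \<beta> > 0 \<longrightarrow> single_valued_lipschitz (1 / \<beta>) B \<longrightarrow>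
        \<kappa> > 0 \<longrightarrow> metrically_subregular F zs 0 \<kappa> \<longrightarrow>
        (\<exists>kb. \<forall>k\<ge>kb. dist_set (x (Suc k)) (Fix T)
          \<le> ereal (sqrt (1 - \<beta>\<^sup>2 * lam k * (2 - lam k) /
                ((\<gamma> + \<beta>)\<^sup>2 * (1 + \<kappa> * sqrt (1 / \<gamma>\<^sup>2 + 1 / \<beta>\<^sup>2))\<^sup>2)))
             * dist_set (x k) (Fix T)))"
proof -
  interpret DR_splitting A B \<gamma> using assms(1,2,5) by unfold_locales
  have l: "0 \<le> lam k" "lam k \<le> 2" for k using assms(6)[of k] by auto
  have ne: "op_inverse (op_add A B) 0 \<noteq> {}" using assms(4) by (simp add: F)
  then obtain p a b where "a \<in> A p" "b \<in> B p" "a + b = 0"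
    by (force simp: op_inverse_def op_add_def)
  hence neF: "Fix T \<noteq> {}" unfolding T using zero_fixed_point by blast
  have Tx: "T (x k) = x k + y k - z k" for k
    by (simp add: T DR_map_eq y z)
  have x': "x (Suc k) = x k + lam k *\<^sub>R (DR_map \<gamma> A B (x k) - x k)" for k
    using Tx[of k] by (simp add: T x)
  obtain xs where xs: "xs \<in> Fix T" "x \<longlonglongrightarrow> xs"
    using relaxed_iteration_converges[OF neF[unfolded T] assms(6,7) x'] unfolding T by blast
  define zs where "zs = resolvent \<gamma> B xs"
  have zs: "zs \<in> op_inverse F 0"
    using fixed_point_zero xs(1) by (simp add: zs_def F T)
  have zlim: "z \<longlonglongrightarrow> zs"
    using continuous_on_tendsto_compose[OF continuous_resolvent[OF assms(2,5)] xs(2)]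
    by (simp add: zs_def z[abs_def])
  have "(\<lambda>k. T (x k) - x k + z k) \<longlonglongrightarrow> T xs - xs + zs"
    using continuous_on_tendsto_compose[OF continuous_T xs(2)]
    by (intro tendsto_intros xs(2) zlim) (simp add: T)
  hence ylim: "y \<longlonglongrightarrow> zs"
    using xs(1) by (simp add: Tx Fix_def)
  have step: "\<exists>a b. DR_step \<gamma> A B (x k) (z k) b (y k) a" for k
    using resolvents_step[OF z[of k] y[of k]] by blast
  have rate: "dist_set (x (Suc k)) (Fix T)
      \<le> ereal (sqrt (1 - lam k * (2 - lam k) / C\<^sup>2)) * dist_set (x k) (Fix T)"
    if "1 \<le> C" "infdist (x k) (Fix T) \<le> C * norm (T (x k) - x k)" for C k
    using relaxed_step_contraction[OF neF[unfolded T] l that(1) that(2)[unfolded T]] neF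
    by (simp add: dist_set_eq_infdist x' T)
  have "(norm (x (Suc k) - w))\<^sup>2
          \<le> (norm (x k - w))\<^sup>2 - lam k * (2 - lam k) * (norm (T (x k) - x k))\<^sup>2"
    if "w \<in> Fix T" for w k
    using relaxed_step_Fejer[OF that[unfolded T] l(1)] by (simp add: x' T)
  moreover have "\<exists>kb. \<forall>k\<ge>kb. dist_set (x (Suc k)) (Fix T)
          \<le> ereal (sqrt (1 - lam k * (2 - lam k) /
                (2 + sqrt (1 + \<gamma>\<^sup>2 / \<beta>\<^sup>2) * (1 + \<kappa> * (1 / \<gamma> + 1 / \<beta>)))\<^sup>2))
             * dist_set (x k) (Fix T)"
    if h: "\<beta> > 0" "single_valued_lipschitz (1 / \<beta>) A" "\<kappa> > 0" "metrically_subregular F zs 0 \<kappa>" for \<beta> \<kappa>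
  proof -
    obtain f where f: "\<And>v. A v = {f v}" "(1/\<beta>)-lipschitz_on UNIV f"
      using h(2) unfolding single_valued_lipschitz_def by blast
    have "\<forall>\<^sub>F k in sequentially. \<forall>u\<in>F (z k). infdist (z k) (op_inverse F 0) \<le> \<kappa> * norm (0 - u)"
      by (rule metrically_subregular_eventually[OF h(4) zlim])
    hence "\<forall>\<^sub>F k in sequentially. dist_set (x (Suc k)) (Fix T)
          \<le> ereal (sqrt (1 - lam k * (2 - lam k) /
                (2 + sqrt (1 + \<gamma>\<^sup>2 / \<beta>\<^sup>2) * (1 + \<kappa> * (1 / \<gamma> + 1 / \<beta>)))\<^sup>2))
             * dist_set (x k) (Fix T)"
    proof eventually_elim
      case (elim k)
      obtain a b where s: "DR_step \<gamma> A B (x k) (z k) b (y k) a" using step by blast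
      show ?case
      proof (rule rate)
        have "0 \<le> sqrt (1 + \<gamma>\<^sup>2 / \<beta>\<^sup>2) * (1 + \<kappa> * (1 / \<gamma> + 1 / \<beta>))"
          using h assms(5) by simp
        thus "1 \<le> 2 + sqrt (1 + \<gamma>\<^sup>2 / \<beta>\<^sup>2) * (1 + \<kappa> * (1 / \<gamma> + 1 / \<beta>))" by simp
        show "infdist (x k) (Fix T) \<le> (2 + sqrt (1 + \<gamma>\<^sup>2 / \<beta>\<^sup>2) * (1 + \<kappa> * (1 / \<gamma> + 1 / \<beta>)))
            * norm (T (x k) - x k)"
          using error_bound_A[OF s f ne h(3)] elim by (simp add: F T power_divide)
      qed
    qed
    thus ?thesis by (simp add: eventually_sequentially)
  qed
  moreover have "\<exists>kb. \<forall>k\<ge>kb. dist_set (x (Suc k)) (Fix T)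
          \<le> ereal (sqrt (1 - \<beta>\<^sup>2 * lam k * (2 - lam k) /
                ((\<gamma> + \<beta>)\<^sup>2 * (1 + \<kappa> * sqrt (1 / \<gamma>\<^sup>2 + 1 / \<beta>\<^sup>2))\<^sup>2)))
             * dist_set (x k) (Fix T)"
    if h: "\<beta> > 0" "single_valued_lipschitz (1 / \<beta>) B" "\<kappa> > 0" "metrically_subregular F zs 0 \<kappa>" for \<beta> \<kappa>
  proof -
    obtain f where f: "\<And>v. B v = {f v}" "(1/\<beta>)-lipschitz_on UNIV f"
      using h(2) unfolding single_valued_lipschitz_def by blast
    define c where "c = 1 + \<kappa> * sqrt (1 / \<gamma>\<^sup>2 + 1 / \<beta>\<^sup>2)"
    define C where "C = (1 + \<gamma> / \<beta>) * c"
    have "0 \<le> \<kappa> * sqrt (1 / \<gamma>\<^sup>2 + 1 / \<beta>\<^sup>2)" using h by simp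
    hence c: "1 \<le> c" by (simp add: c_def)
    \<comment> \<open>The contraction factor for the error constant \<open>C\<close>, with \<open>\<beta>\<^sup>2\<close> cleared from the denominator.\<close>
    have "1 + \<gamma> / \<beta> = (\<gamma> + \<beta>) / \<beta>" using h(1) by (simp add: field_simps)
    hence "C\<^sup>2 = (\<gamma> + \<beta>)\<^sup>2 * c\<^sup>2 / \<beta>\<^sup>2"
      by (simp add: C_def power_mult_distrib power_divide)
    hence Ceq: "lam k * (2 - lam k) / C\<^sup>2 = \<beta>\<^sup>2 * lam k * (2 - lam k) / ((\<gamma> + \<beta>)\<^sup>2 * c\<^sup>2)" for k
      using h(1) by (simp add: mult_ac)
    have C: "1 \<le> C"
      unfolding C_def using mult_mono[of 1 "1 + \<gamma> / \<beta>" 1 c] c h(1) assms(5) by simp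
    have "\<forall>\<^sub>F k in sequentially. \<forall>u\<in>F (y k). infdist (y k) (op_inverse F 0) \<le> \<kappa> * norm (0 - u)"
      by (rule metrically_subregular_eventually[OF h(4) ylim])
    hence "\<forall>\<^sub>F k in sequentially. dist_set (x (Suc k)) (Fix T)
          \<le> ereal (sqrt (1 - lam k * (2 - lam k) / C\<^sup>2)) * dist_set (x k) (Fix T)"
    proof eventually_elim
      case (elim k)
      obtain a b where s: "DR_step \<gamma> A B (x k) (z k) b (y k) a" using step by blast
      show ?case
        using error_bound_B[OF s f ne h(3)] elim
        by (intro rate C) (simp add: F T C_def c_def power_divide)
    qed
    thus ?thesis by (simp add: eventually_sequentially Ceq c_def)
  qed
  ultimately show ?thesis
    using zs ylim zlim xs by (intro exI[of _ zs] exI[of _ xs]) blast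
qed

end
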